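(* Let $I$ be a finite set, let $X\subseteq Y_2\times I^2$ and let $Z$ be its complement, i.e. $X\sqcup Z=Y_2\times I^2$. Then the alternate generating series of $X$ and $Z$ are inverse to each other for composition of formal power series: $$f(X,f(Z,t))=t.$$
   Context: $Y_n$ denotes the set of planar binary rooted trees with $n$ internal vertices (each internal vertex has exactly two children, left and right; $Y_0=\{\,|\,\}$ is the tree with a single leaf and no vertex). The leaves of $y\in Y_n$ are numbered $0,\dots,n$ from left to right, and the vertices are numbered $1,\dots,n$, vertex $i$ lying between leaves $i-1$ and $i$. A labelled tree of degree $n$ is an element of $Y_n\times I^n$: a tree $y\in Y_n$ with vertex $i$ labelled by an element $\epsilon(i)\in I$ (labels need not be distinct). $Y_2=\{L,R\}$, where $L$ is the tree whose non-root vertex is the right child of the root vertex (so $L=a\vee(b\vee c)$ with $a,b,c$ leaves, where $\vee$ is grafting of trees to a new root vertex), and $R$ is the tree whose non-root vertex is the left child of the root vertex ($R=(a\vee b)\vee c$). Thus in $(L;i_1,i_2)$ the root vertex has label $i_1$ and its right child has label $i_2$; in $(R;i_1,i_2)$ the left child has label $i_1$ and the root vertex has label $i_2$. A pair of adjacent vertices (a vertex and one of its children) in a labelled tree determines a labelled subtree in $Y_2\times I^2$, called a local pattern. For $X\subseteq Y_2\times I^2$, $X_n\subseteq Y_n\times I^n$ is the set of labelled trees all of whose local patterns belong to $X$; by convention $X_0=Y_0\times I^0$ (one element) and $X_1=Y_1\times I$. One has $X_2=X$. The sets $Z_n$ are defined in the same way from $Z$. The alternate generating series of $X$ is $f(X,t)=\sum_{n\ge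 0}(-1)^{n+1}(\#X_n)\,t^{n+1}=-t+(\#I)t^2-(\#X)t^3+\cdots$, and similarly $f(Z,t)=\sum_{n\ge0}(-1)^{n+1}(\#Z_n)t^{n+1}$. *)

theory Defs
  imports "HOL-Library.Tree" "HOL-Computational_Algebra.Formal_Power_Series"
begin

text \<open>
  A labelled tree of degree \<open>n\<close>, i.e. an element of \<open>Y\<^sub>n \<times> I\<^sup>n\<close>, is encoded as a library
  binary tree with \<open>n\<close> inner nodes (\<^const>\<open>Leaf\<close> is the tree without vertex) that carries its
  labels in the nodes.  The numbering of the vertices, vertex \<open>i\<close> lying between the leaves
  \<open>i - 1\<close> and \<open>i\<close>, is the inorder numbering, so the underlying pair consists of the shape and
  the inorder list of labels; see \<open>bij_betw_labelled_trees\<close>.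
\<close>

definition labelled_trees :: "'i set \<Rightarrow> nat \<Rightarrow> 'i tree set" where
  "labelled_trees I n = {t. size t = n \<and> set_tree t \<subseteq> I}"

text \<open>The elements \<open>(L; i, j)\<close> and \<open>(R; i, j)\<close> of \<open>Y\<^sub>2 \<times> I\<^sup>2\<close>.\<close>

definition pattern_L :: "'i \<Rightarrow> 'i \<Rightarrow> 'i tree" where
  "pattern_L i j = Node Leaf i (Node Leaf j Leaf)"

definition pattern_R :: "'i \<Rightarrow> 'i \<Rightarrow> 'i tree" where
  "pattern_R i j = Node (Node Leaf i Leaf) j Leaf"

text \<open>The local patterns spanned by the root and one of its children.\<close>

definition root_patterns :: "'i tree \<Rightarrow> 'i tree set" where
  "root_patterns t =
     {pattern_L i j | i j. \<exists>l l' r'. t = Node l i (Node l' j r')} \<union>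
     {pattern_R i j | i j. \<exists>l' r' r. t = Node (Node l' i r') j r}"

definition local_patterns :: "'i tree \<Rightarrow> 'i tree set" where
  "local_patterns t = (\<Union>s \<in> subtrees t. root_patterns s)"

text \<open>The set \<open>X\<^sub>n\<close>.  For \<open>n \<le> 1\<close> there are no local patterns, so it is all of \<open>Y\<^sub>n \<times> I\<^sup>n\<close>.\<close>

definition pattern_trees :: "'i set \<Rightarrow> 'i tree set \<Rightarrow> nat \<Rightarrow> 'i tree set" where
  "pattern_trees I X n = {t \<in> labelled_trees I n. local_patterns t \<subseteq> X}"

definition alt_gen_series :: "'i set \<Rightarrow> 'i tree set \<Rightarrow> int fps" where
  "alt_gen_series I X =
     Abs_fps (\<lambda>k. case k of 0 \<Rightarrow> 0 | Suc n \<Rightarrow> (-1) ^ (n + 1) * int (card (pattern_trees I X n)))"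

lemma labelled_trees_0: "labelled_trees I 0 = {Leaf}"
  by (auto simp: labelled_trees_def)

lemma labelled_trees_1: "labelled_trees I (Suc 0) = (\<lambda>i. Node Leaf i Leaf) ` I"
proof -
  have "\<exists>i \<in> I. t = Node Leaf i Leaf" if "size t = Suc 0" "set_tree t \<subseteq> I" for t
    using that by (cases t) auto
  then show ?thesis
    by (auto simp: labelled_trees_def)
qed

lemma labelled_trees_2:
  "labelled_trees I 2 = {pattern_L i j | i j. i \<in> I \<and> j \<in> I} \<union> {pattern_R i j | i j. i \<in> I \<and> j \<in> I}"
  (is "?A = ?B")
proof
  show "?B \<subseteq> ?A"
    by (auto simp: labelled_trees_def pattern_L_def pattern_R_def)
  show "?A \<subseteq> ?B"
  proof
    fix t assume "t \<in> ?A"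
    then have t: "size t = 2" "set_tree t \<subseteq> I"
      by (auto simp: labelled_trees_def)
    then obtain l a r where lar: "t = Node l a r"
      by (cases t) auto
    show "t \<in> ?B"
    proof (cases l)
      case Leaf
      then obtain l' b r' where "r = Node l' b r'"
        using t lar by (cases r) auto
      then show ?thesis
        using t lar Leaf by (auto simp: pattern_L_def)
    next
      case (Node l' b r')
      then show ?thesis
        using t lar by (auto simp: pattern_R_def)
    qed
  qed
qed

lemma root_patterns_simps [simp]:
  "root_patterns Leaf = {}"
  "root_patterns (Node Leaf a Leaf) = {}"
  "root_patterns (Node Leaf a (Node l' c r')) = {pattern_L a c}"
  "root_patterns (Node (Node l b r) a Leaf) = {pattern_R b a}"
  "root_patterns (Node (Node l b r) a (Node l' c r')) = {pattern_R b a, pattern_L a c}"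
  by (auto simp: root_patterns_def)

lemma pattern_trees_0: "pattern_trees I X 0 = {Leaf}"
  by (auto simp: pattern_trees_def labelled_trees_0 local_patterns_def)

lemma pattern_trees_1: "pattern_trees I X (Suc 0) = (\<lambda>i. Node Leaf i Leaf) ` I"
  by (auto simp: pattern_trees_def labelled_trees_1 local_patterns_def)

lemma pattern_trees_2:
  assumes "X \<subseteq> labelled_trees I 2"
  shows "pattern_trees I X 2 = X"
proof -
  have "local_patterns t = {t}" if "t \<in> labelled_trees I 2" for t
    using that by (auto simp: labelled_trees_2 local_patterns_def)
      (auto simp: pattern_L_def pattern_R_def)
  then show ?thesis
    using assms by (auto simp: pattern_trees_def)
qed

lemma tree_eq_if_shape_inorder:
  assumes "map_tree (\<lambda>_. ()) s = map_tree (\<lambda>_. ()) t" "inorder s = inorder t"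
  shows "s = t"
  using assms
proof (induction s arbitrary: t)
  case Leaf
  then show ?case by (cases t) auto
next
  case (Node l a r)
  then obtain l' a' r' where t: "t = Node l' a' r'"
    by (cases t) auto
  have "size l = size l'"
    using Node.prems(1) t by (metis size_map_tree tree.inject tree.map(2))
  then have "length (inorder l) = length (inorder l')"
    by simp
  then show ?case
    using Node t by auto
qed

lemma exists_tree_shape_inorder:
  "length xs = size (y :: unit tree) \<Longrightarrow> \<exists>t. map_tree (\<lambda>_. ()) t = y \<and> inorder t = xs"
proof (induction y arbitrary: xs)
  case Leaf
  then show ?case by (intro exI[of _ Leaf]) simp
next
  case (Node l u r)
  define ys where "ys = take (size l) xs"
  define zs where "zs = drop (Suc (size l)) xs"
  have xs: "xs = ys @ xs ! size l # zs"
    unfolding ys_def zs_def using Node.prems by (intro id_take_nth_drop) simp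
  have "length ys = size l" "length zs = size r"
    using Node.prems by (auto simp: ys_def zs_def)
  then obtain s t where "map_tree (\<lambda>_. ()) s = l" "inorder s = ys"
    "map_tree (\<lambda>_. ()) t = r" "inorder t = zs"
    using Node.IH by metis
  then show ?case
    using xs by (intro exI[of _ "Node s (xs ! size l) t"]) simp
qed

lemma bij_betw_labelled_trees:
  "bij_betw (\<lambda>t. (map_tree (\<lambda>_. ()) t, inorder t)) (labelled_trees I n)
     ({y. size y = n} \<times> {xs. length xs = n \<and> set xs \<subseteq> I})"
proof (rule bij_betwI')
  fix p :: "unit tree \<times> 'a list"
  assume p: "p \<in> {y. size y = n} \<times> {xs. length xs = n \<and> set xs \<subseteq> I}"
  then obtain t where t: "map_tree (\<lambda>_. ()) t = fst p" "inorder t = snd p"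
    using exists_tree_shape_inorder[of "snd p" "fst p"] by auto
  have "length (inorder t) = n" "set (inorder t) \<subseteq> I"
    using p by (auto simp: t(2))
  then have "t \<in> labelled_trees I n"
    by (simp add: labelled_trees_def)
  with t show "\<exists>t \<in> labelled_trees I n. p = (map_tree (\<lambda>_. ()) t, inorder t)"
    by (metis prod.collapse)
qed (auto simp: labelled_trees_def dest: tree_eq_if_shape_inorder)

end

theory Submission
  imports Defs
begin

text \<open>
  Give a tree with \<open>n\<close> vertices the weight \<open>(-t)^(n + 1)\<close>, that is, a factor \<open>-t\<close> for each leaf;
  then the weight of \<open>Node l a r\<close> is the product of the weights of \<open>l\<close> and \<open>r\<close>.  Let \<open>x\<^sub>a\<close> be the
  sum of the weights of the trees with root label \<open>a\<close> and all local patterns in \<open>X\<close>.  Splitting at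
  the root (\<open>tree_series_rooted_trees\<close>) gives the system
  \<open>x\<^sub>a = (-t + (\<Sum>j | (R; j, a) \<in> X. x\<^sub>j)) * (-t + (\<Sum>j | (L; a, j) \<in> X. x\<^sub>j))\<close>,
  and \<open>f(X, t) = -t + (\<Sum>a. x\<^sub>a)\<close> (\<open>alt_gen_series_eq\<close>).  The same holds for \<open>Z\<close>, with
  series \<open>z\<^sub>a\<close>.

  Put \<open>g = f(Z, t)\<close>.  Substituting \<open>g\<close> for \<open>t\<close> shows that the series \<open>x\<^sub>a(g)\<close> solve the system
  with \<open>-t\<close> replaced by \<open>-g\<close>.  So do the series \<open>z\<^sub>a\<close>: since \<open>g = -t + (\<Sum>a. z\<^sub>a)\<close> and \<open>Z\<close> is the
  complement of \<open>X\<close>,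
  \<open>-g + (\<Sum>j | (R; j, a) \<in> X. z\<^sub>j) = -(-t + (\<Sum>j | (R; j, a) \<in> Z. z\<^sub>j))\<close>,
  likewise for \<open>L\<close>, and the two signs cancel in the product.  The system determines its solution
  without constant terms coefficient by coefficient (\<open>quadratic_system_unique\<close>), hence
  \<open>x\<^sub>a(g) = z\<^sub>a\<close> and \<open>f(X, g) = -g + (\<Sum>a. z\<^sub>a) = t\<close>.
\<close>

section \<open>Weight series of classes of trees\<close>

text \<open>
  The sum of the weights \<open>(-t)^(n + 1)\<close> of the trees of a class, where \<open>n + 1\<close> is the number
  \<^const>\<open>size1\<close> of leaves.  It is meaningful only if the class has finitely many trees of each size.
\<close>

definition tree_series :: "'i tree set \<Rightarrow> int fps" where
  "tree_series S = Abs_fps (\<lambda>k. (-1) ^ k * int (card {t \<in> S. size1 t = k}))"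

lemma finite_trees_size1:
  assumes "finite I"
  shows "finite {t. set_tree t \<subseteq> I \<and> size1 t = k}"
proof -
  have "finite ({y :: unit tree. size y = n})" for n
  proof (induction n rule: less_induct)
    case (less n)
    have "{y :: unit tree. size y = n} \<subseteq>
      insert Leaf ((\<lambda>(l, r). Node l () r) ` ((\<Union>m<n. {y. size y = m}) \<times> (\<Union>m<n. {y. size y = m})))"
      (is "_ \<subseteq> ?B")
    proof
      fix y :: "unit tree" assume "y \<in> {y. size y = n}"
      then show "y \<in> ?B"
        by (cases y) (auto simp: image_iff)
    qed
    moreover have "finite ?B"
      using less by (intro finite.insertI finite_imageI finite_cartesian_product finite_UN_I) auto
    ultimately show ?case
      by (rule finite_subset)
  qed
  moreover have "finite {xs. length xs = n \<and> set xs \<subseteq> I}" for n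
    using finite_lists_length_eq[OF assms, of n] by (simp add: conj_commute)
  ultimately have "finite (labelled_trees I n)" for n
    using bij_betw_finite[OF bij_betw_labelled_trees] by blast
  moreover have "{t. set_tree t \<subseteq> I \<and> size1 t = k} \<subseteq> labelled_trees I (k - 1)"
    by (auto simp: labelled_trees_def size1_size)
  ultimately show ?thesis
    by (rule finite_subset[rotated])
qed

lemma finite_level:
  assumes "finite I" "\<And>t. t \<in> S \<Longrightarrow> set_tree t \<subseteq> I"
  shows "finite {t \<in> S. size1 t = k}"
  by (rule finite_subset[OF _ finite_trees_size1[OF assms(1), of k]]) (use assms(2) in auto)

lemma tree_series_nth_0 [simp]: "fps_nth (tree_series S) 0 = 0"
  by (simp add: tree_series_def size1_size)

lemma tree_series_UN:
  assumes "finite I" "finite J" "\<And>j t. j \<in> J \<Longrightarrow> t \<in> S j \<Longrightarrow> set_tree t \<subseteq> I"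
    and "\<And>i j. i \<in> J \<Longrightarrow> j \<in> J \<Longrightarrow> i \<noteq> j \<Longrightarrow> S i \<inter> S j = {}"
  shows "tree_series (\<Union>j\<in>J. S j) = (\<Sum>j\<in>J. tree_series (S j))"
proof (rule fps_ext)
  fix k
  have "{t \<in> (\<Union>j\<in>J. S j). size1 t = k} = (\<Union>j\<in>J. {t \<in> S j. size1 t = k})"
    by auto
  moreover have "card (\<Union>j\<in>J. {t \<in> S j. size1 t = k}) = (\<Sum>j\<in>J. card {t \<in> S j. size1 t = k})"
  proof (rule card_UN_disjoint)
    show "\<forall>j\<in>J. finite {t \<in> S j. size1 t = k}"
      using assms(3) by (intro ballI finite_level[OF assms(1)])
    show "\<forall>i\<in>J. \<forall>j\<in>J. i \<noteq> j \<longrightarrow> {t \<in> S i. size1 t = k} \<inter> {t \<in> S j. size1 t = k} = {}"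
      using assms(4) by blast
  qed (fact assms(2))
  ultimately show "fps_nth (tree_series (\<Union>j\<in>J. S j)) k = fps_nth (\<Sum>j\<in>J. tree_series (S j)) k"
    by (simp add: tree_series_def fps_sum_nth sum_distrib_left)
qed

lemma tree_series_insert_Leaf:
  assumes "finite I" "\<And>t. t \<in> S \<Longrightarrow> set_tree t \<subseteq> I" "Leaf \<notin> S"
  shows "tree_series (insert Leaf S) = - fps_X + tree_series S"
proof (rule fps_ext)
  fix k
  have "{t \<in> insert Leaf S. size1 t = k} =
      (if k = 1 then insert Leaf {t \<in> S. size1 t = k} else {t \<in> S. size1 t = k})"
    by auto
  moreover have "finite {t \<in> S. size1 t = k}"
    using assms by (intro finite_level)
  ultimately show "fps_nth (tree_series (insert Leaf S)) k = fps_nth (- fps_X + tree_series S) k"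
    using assms(3) by (auto simp: tree_series_def fps_X_def)
qed

text \<open>Since \<^const>\<open>size1\<close> is additive under grafting, grafting multiplies the series.\<close>

lemma tree_series_graft:
  assumes "finite I" "\<And>t. t \<in> P \<union> Q \<Longrightarrow> set_tree t \<subseteq> I"
  shows "tree_series ((\<lambda>(l, r). Node l a r) ` (P \<times> Q)) = tree_series P * tree_series Q"
proof (rule fps_ext)
  fix k
  let ?N = "\<lambda>(l, r). Node l a r"
  let ?P = "\<lambda>i. {t \<in> P. size1 t = i}" and ?Q = "\<lambda>i. {t \<in> Q. size1 t = i}"
  have fin: "finite (?P i)" "finite (?Q i)" for i
    using assms by (auto intro: finite_level)
  have "{t \<in> ?N ` (P \<times> Q). size1 t = k} = ?N ` (\<Union>i\<in>{0..k}. ?P i \<times> ?Q (k - i))"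
    by (force simp: image_iff)
  moreover have "card (?N ` (\<Union>i\<in>{0..k}. ?P i \<times> ?Q (k - i))) = card (\<Union>i\<in>{0..k}. ?P i \<times> ?Q (k - i))"
    by (intro card_image inj_onI) auto
  moreover have "\<dots> = (\<Sum>i\<in>{0..k}. card (?P i \<times> ?Q (k - i)))"
    using fin by (intro card_UN_disjoint) auto
  ultimately have card: "card {t \<in> ?N ` (P \<times> Q). size1 t = k} = (\<Sum>i=0..k. card (?P i) * card (?Q (k - i)))"
    by (simp add: card_cartesian_product)
  have "(-1) ^ k * (int (card (?P i)) * int (card (?Q (k - i)))) =
      ((-1) ^ i * int (card (?P i))) * ((-1) ^ (k - i) * int (card (?Q (k - i))))"
    if "i \<in> {0..k}" for i
  proof -
    have "(-1 :: int) ^ k = (-1) ^ i * (-1) ^ (k - i)"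
      using that by (simp flip: power_add)
    then show ?thesis
      by simp
  qed
  then show "fps_nth (tree_series (?N ` (P \<times> Q))) k = fps_nth (tree_series P * tree_series Q) k"
    unfolding tree_series_def fps_mult_nth fps_nth_Abs_fps card
    by (simp only: sum_distrib_left of_nat_sum of_nat_mult) (rule sum.cong[OF refl])
qed

section \<open>Decomposition at the root\<close>

text \<open>The trees with root label \<open>a\<close> in the union of all \<open>X\<^sub>n\<close>.\<close>

definition rooted_trees :: "'i set \<Rightarrow> 'i tree set \<Rightarrow> 'i \<Rightarrow> 'i tree set" where
  "rooted_trees I X a =
     {t. set_tree t \<subseteq> I \<and> local_patterns t \<subseteq> X \<and> (\<exists>l r. t = Node l a r)}"

lemma alt_gen_series_eq:
  assumes "finite I"
  shows "alt_gen_series I X = - fps_X + (\<Sum>a\<in>I. tree_series (rooted_trees I X a))"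
proof -
  let ?S = "\<Union>a\<in>I. rooted_trees I X a"
  have S: "t \<in> insert Leaf ?S \<longleftrightarrow> set_tree t \<subseteq> I \<and> local_patterns t \<subseteq> X" for t
    by (cases t) (auto simp: rooted_trees_def local_patterns_def)
  have "pattern_trees I X n = {t \<in> insert Leaf ?S. size1 t = Suc n}" for n
    unfolding S by (auto simp: pattern_trees_def labelled_trees_def size1_size)
  then have "fps_nth (alt_gen_series I X) (Suc n) = fps_nth (tree_series (insert Leaf ?S)) (Suc n)"
    for n
    by (simp add: alt_gen_series_def tree_series_def)
  moreover have "fps_nth (alt_gen_series I X) 0 = fps_nth (tree_series (insert Leaf ?S)) 0"
    by (simp add: alt_gen_series_def)
  ultimately have "fps_nth (alt_gen_series I X) k = fps_nth (tree_series (insert Leaf ?S)) k" for k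
    by (cases k) simp_all
  then have "alt_gen_series I X = tree_series (insert Leaf ?S)"
    by (rule fps_ext)
  also have "\<dots> = - fps_X + tree_series ?S"
    by (rule tree_series_insert_Leaf[OF assms]) (auto simp: rooted_trees_def)
  also have "tree_series ?S = (\<Sum>a\<in>I. tree_series (rooted_trees I X a))"
    by (rule tree_series_UN[OF assms assms]) (auto simp: rooted_trees_def)
  finally show ?thesis .
qed

lemma root_patterns_Node:
  "root_patterns (Node l a r) =
     {pattern_R j a | j. \<exists>l' r'. l = Node l' j r'} \<union> {pattern_L a j | j. \<exists>l' r'. r = Node l' j r'}"
  by (auto simp: root_patterns_def)

lemma tree_series_rooted_trees:
  assumes "finite I" "a \<in> I"
  shows "tree_series (rooted_trees I X a) =
    (- fps_X + (\<Sum>j | j \<in> I \<and> pattern_R j a \<in> X. tree_series (rooted_trees I X j))) *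
    (- fps_X + (\<Sum>j | j \<in> I \<and> pattern_L a j \<in> X. tree_series (rooted_trees I X j)))"
proof -
  let ?C = "\<lambda>J. \<Union>j\<in>J. rooted_trees I X j"
  let ?P = "{j. j \<in> I \<and> pattern_R j a \<in> X}" and ?Q = "{j. j \<in> I \<and> pattern_L a j \<in> X}"
  have C: "tree_series (insert Leaf (?C J)) = - fps_X + (\<Sum>j\<in>J. tree_series (rooted_trees I X j))"
    if "J \<subseteq> I" for J
  proof -
    have "tree_series (insert Leaf (?C J)) = - fps_X + tree_series (?C J)"
      by (rule tree_series_insert_Leaf[OF assms(1)]) (auto simp: rooted_trees_def)
    also have "tree_series (?C J) = (\<Sum>j\<in>J. tree_series (rooted_trees I X j))"
      by (rule tree_series_UN[OF assms(1) finite_subset[OF that assms(1)]])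
        (auto simp: rooted_trees_def)
    finally show ?thesis .
  qed
  \<comment> \<open>The condition on a child of a vertex; a leaf satisfies it, since it spans no pattern.\<close>
  have child: "s \<in> insert Leaf (?C {j. j \<in> I \<and> p j \<in> X}) \<longleftrightarrow> set_tree s \<subseteq> I \<and> local_patterns s \<subseteq> X \<and>
      {p j | j. \<exists>l r. s = Node l j r} \<subseteq> X" for s and p :: "'a \<Rightarrow> 'a tree"
    by (cases s) (auto simp: rooted_trees_def local_patterns_def)
  have node: "Node l a r \<in> rooted_trees I X a \<longleftrightarrow> l \<in> insert Leaf (?C ?P) \<and> r \<in> insert Leaf (?C ?Q)"
    for l r
    unfolding child using assms(2)
    by (auto simp: rooted_trees_def local_patterns_def root_patterns_Node)
  have "rooted_trees I X a = (\<lambda>(l, r). Node l a r) ` (insert Leaf (?C ?P) \<times> insert Leaf (?C ?Q))"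
    (is "_ = ?R")
  proof (intro set_eqI iffI)
    fix t assume t: "t \<in> rooted_trees I X a"
    then obtain l r where "t = Node l a r"
      by (auto simp: rooted_trees_def)
    with t have "t = (\<lambda>(l, r). Node l a r) (l, r)"
        "(l, r) \<in> insert Leaf (?C ?P) \<times> insert Leaf (?C ?Q)"
      by (simp_all only: node prod.case mem_Sigma_iff)
    then show "t \<in> ?R"
      by (rule image_eqI)
  next
    fix t assume "t \<in> ?R"
    then obtain l r where "t = Node l a r" "l \<in> insert Leaf (?C ?P)" "r \<in> insert Leaf (?C ?Q)"
      by (elim imageE SigmaE) (simp only: prod.case)
    then show "t \<in> rooted_trees I X a"
      by (simp only: node)
  qed
  moreover have "tree_series ((\<lambda>(l, r). Node l a r) ` (insert Leaf (?C ?P) \<times> insert Leaf (?C ?Q))) =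
      tree_series (insert Leaf (?C ?P)) * tree_series (insert Leaf (?C ?Q))"
    by (rule tree_series_graft[OF assms(1)]) (auto simp: rooted_trees_def)
  ultimately show ?thesis
    by (simp add: C)
qed

section \<open>Uniqueness for quadratic systems of power series\<close>

text \<open>
  If no series involved has a constant term, then the coefficient of degree \<open>n\<close> of a product
  depends only on the coefficients of lower degree of its factors.
\<close>

lemma quadratic_system_unique:
  fixes u v :: "'i \<Rightarrow> 'a :: comm_ring_1 fps"
  assumes "fps_nth h 0 = 0" "\<And>a. a \<in> I \<Longrightarrow> P a \<subseteq> I" "\<And>a. a \<in> I \<Longrightarrow> Q a \<subseteq> I"
    and u0: "\<And>a. a \<in> I \<Longrightarrow> fps_nth (u a) 0 = 0" and v0: "\<And>a. a \<in> I \<Longrightarrow> fps_nth (v a) 0 = 0"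
    and u: "\<And>a. a \<in> I \<Longrightarrow> u a = (h + (\<Sum>j\<in>P a. u j)) * (h + (\<Sum>j\<in>Q a. u j))"
    and v: "\<And>a. a \<in> I \<Longrightarrow> v a = (h + (\<Sum>j\<in>P a. v j)) * (h + (\<Sum>j\<in>Q a. v j))"
    and "a \<in> I"
  shows "u a = v a"
proof (rule fps_ext)
  fix n
  show "fps_nth (u a) n = fps_nth (v a) n"
    using \<open>a \<in> I\<close>
  proof (induction n arbitrary: a rule: less_induct)
    case (less n)
    have factor: "fps_nth (h + (\<Sum>j\<in>J. u j)) m = fps_nth (h + (\<Sum>j\<in>J. v j)) m"
      if "J \<subseteq> I" "m < n" for J m
      using that less.IH by (auto simp: fps_sum_nth intro!: sum.cong)
    have zero: "fps_nth (h + (\<Sum>j\<in>J. w j)) 0 = 0"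
      if "J \<subseteq> I" "\<And>j. j \<in> I \<Longrightarrow> fps_nth (w j) 0 = 0" for J and w :: "'i \<Rightarrow> 'a fps"
      using that assms(1) by (auto simp: fps_sum_nth intro!: sum.neutral)
    have "fps_nth (h + (\<Sum>j\<in>P a. u j)) i * fps_nth (h + (\<Sum>j\<in>Q a. u j)) (n - i) =
        fps_nth (h + (\<Sum>j\<in>P a. v j)) i * fps_nth (h + (\<Sum>j\<in>Q a. v j)) (n - i)"
      if "i \<in> {0..n}" for i
    proof -
      have PQ: "P a \<subseteq> I" "Q a \<subseteq> I"
        using assms(2,3) less.prems by auto
      have "i = 0 \<or> i = n \<or> (i < n \<and> n - i < n)"
        using that by auto
      then consider "i = 0" | "i = n" | "i < n" "n - i < n"
        by blast
      \<comment> \<open>In the two extreme terms one of the factors is a constant term, hence \<open>0\<close>.\<close>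
      then show ?thesis
      proof cases
        case 1
        then show ?thesis
          by (simp only: zero[OF PQ(1) u0] zero[OF PQ(1) v0] mult_zero_left)
      next
        case 2
        then show ?thesis
          by (simp only: diff_self_eq_0 zero[OF PQ(2) u0] zero[OF PQ(2) v0] mult_zero_right)
      next
        case 3
        then show ?thesis
          by (simp only: factor[OF PQ(1)] factor[OF PQ(2)])
      qed
    qed
    then have "fps_nth ((h + (\<Sum>j\<in>P a. u j)) * (h + (\<Sum>j\<in>Q a. u j))) n =
        fps_nth ((h + (\<Sum>j\<in>P a. v j)) * (h + (\<Sum>j\<in>Q a. v j))) n"
      unfolding fps_mult_nth by (rule sum.cong[OF refl])
    then show ?case
      using u[OF less.prems] v[OF less.prems] by simp
  qed
qed

section \<open>Composition of the two alternate generating series\<close>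

lemma alt_gen_series_compose:
  assumes "finite I" "Z = labelled_trees I 2 - X"
  shows "alt_gen_series I X oo alt_gen_series I Z = fps_X"
proof -
  define g where "g = alt_gen_series I Z"
  define x where "x = (\<lambda>a. tree_series (rooted_trees I X a))"
  define z where "z = (\<lambda>a. tree_series (rooted_trees I Z a))"
  have g: "g = - fps_X + (\<Sum>a\<in>I. z a)"
    by (simp add: g_def z_def alt_gen_series_eq[OF assms(1)])
  have g0 [simp]: "fps_nth g 0 = 0"
    by (simp add: g_def alt_gen_series_def)
  let ?P = "\<lambda>a. {j. j \<in> I \<and> pattern_R j a \<in> X}" and ?Q = "\<lambda>a. {j. j \<in> I \<and> pattern_L a j \<in> X}"
  have xg: "x a oo g = (- g + (\<Sum>j\<in>?P a. x j oo g)) * (- g + (\<Sum>j\<in>?Q a. x j oo g))" if "a \<in> I" for a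
  proof -
    have "x a = (- fps_X + (\<Sum>j\<in>?P a. x j)) * (- fps_X + (\<Sum>j\<in>?Q a. x j))"
      unfolding x_def by (rule tree_series_rooted_trees[OF assms(1) that])
    then have "x a oo g = ((- fps_X + (\<Sum>j\<in>?P a. x j)) * (- fps_X + (\<Sum>j\<in>?Q a. x j))) oo g"
      by simp
    then show ?thesis
      by (simp only: fps_compose_mult_distrib[OF g0] fps_compose_add_distrib fps_compose_uminus
          fps_compose_sum_distrib fps_X_fps_compose_startby0[OF g0])
  qed
  have complement: "- fps_X + (\<Sum>j | j \<in> I \<and> p j \<in> Z. z j) = - (- g + (\<Sum>j | j \<in> I \<and> p j \<in> X. z j))"
    if "\<And>j. j \<in> I \<Longrightarrow> p j \<in> labelled_trees I 2" for p :: "'a \<Rightarrow> 'a tree"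
  proof -
    have "{j. j \<in> I \<and> p j \<in> Z} = I - {j. j \<in> I \<and> p j \<in> X}"
      using that assms(2) by auto
    then have "(\<Sum>j | j \<in> I \<and> p j \<in> Z. z j) = (\<Sum>j\<in>I. z j) - (\<Sum>j | j \<in> I \<and> p j \<in> X. z j)"
      using assms(1) by (simp add: sum_diff)
    then show ?thesis
      by (simp add: g)
  qed
  have zg: "z a = (- g + (\<Sum>j\<in>?P a. z j)) * (- g + (\<Sum>j\<in>?Q a. z j))" if "a \<in> I" for a
  proof -
    have "z a = (- fps_X + (\<Sum>j | j \<in> I \<and> pattern_R j a \<in> Z. z j)) *
        (- fps_X + (\<Sum>j | j \<in> I \<and> pattern_L a j \<in> Z. z j))"
      unfolding z_def by (rule tree_series_rooted_trees[OF assms(1) that])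
    also have "\<dots> = (- (- g + (\<Sum>j\<in>?P a. z j))) * (- (- g + (\<Sum>j\<in>?Q a. z j)))"
      using that by (subst (1 2) complement) (auto simp: labelled_trees_2)
    finally show ?thesis
      by (simp only: minus_mult_minus)
  qed
  have "x a oo g = z a" if "a \<in> I" for a
  proof (rule quadratic_system_unique[where h = "- g" and I = I and P = ?P and Q = ?Q
        and u = "\<lambda>a. x a oo g" and v = z])
    show "fps_nth (x b oo g) 0 = 0" "fps_nth (z b) 0 = 0" for b
      by (simp_all add: x_def z_def)
  qed (fact xg zg that | force)+
  then have "(\<Sum>a\<in>I. x a oo g) = (\<Sum>a\<in>I. z a)"
    by (rule sum.cong[OF refl])
  moreover have "alt_gen_series I X = - fps_X + (\<Sum>a\<in>I. x a)"
    unfolding x_def by (rule alt_gen_series_eq[OF assms(1)])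
  ultimately have "alt_gen_series I X oo g = - g + (\<Sum>a\<in>I. z a)"
    by (simp only: fps_compose_add_distrib fps_compose_uminus fps_compose_sum_distrib
        fps_X_fps_compose_startby0[OF g0])
  also have "\<dots> = fps_X"
    by (simp add: g)
  finally show ?thesis
    by (simp add: g_def)
qed

theorem theorem2p2:
  fixes I :: "'i set" and X Z :: "'i tree set"
  assumes "finite I"
    and "X \<subseteq> labelled_trees I 2"
    and "Z = labelled_trees I 2 - X"
  shows "alt_gen_series I X oo alt_gen_series I Z = fps_X \<and>
         alt_gen_series I Z oo alt_gen_series I X = fps_X"
proof
  show "alt_gen_series I X oo alt_gen_series I Z = fps_X"
    using assms(1,3) by (rule alt_gen_series_compose)
  have "X = labelled_trees I 2 - Z"
    using assms(2,3) by auto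
  then show "alt_gen_series I Z oo alt_gen_series I X = fps_X"
    by (rule alt_gen_series_compose[OF assms(1)])
qed

end
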